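(* Let $n\ge3$ and let $S=\langle a_1,\dots,a_n\rangle\subseteq\mathbb{N}^d$ (minimal generators) be a gluing of two MPD-semigroups. Then $I_S$ is not generic.
   Context: $\mathbb{N}$ denotes the non-negative integers. An affine semigroup $T$ is a finitely generated submonoid of $\mathbb{N}^d$, with unique minimal generating set $\{b_1,\dots,b_m\}$. Let $k$ be a field. The semigroup ring is $k[T]=k[\mathbf{t}^{b_1},\dots,\mathbf{t}^{b_m}]\subseteq k[t_1,\dots,t_d]$, a module over $R=k[x_1,\dots,x_m]$ via $x_i\mapsto\mathbf{t}^{b_i}$, and $I_T$ is the kernel of this map $R\to k[T]$. $T$ is an MPD-semigroup (maximal projective dimension) if $\mathrm{pdim}_R\,k[T]=m-1$ (equivalently $\mathrm{depth}_R\,k[T]=1$). A binomial $\mathbf{x}^u-\mathbf{x}^v$ has full support if every variable of the polynomial ring occurs in $\mathbf{x}^u$ or $\mathbf{x}^v$. $I_S$ is generic if it has a minimal generating set consisting of binomials of full support. Gluing: let $G(T)=\{a-b\mid a,b\in T\}\subseteq\mathbb{Z}^d$ be the group spanned by $T$. Let $A$ be the minimal generating set of $S$, $A=A_1\amalg A_2$ a partition into nonempty subsets, and $S_i$ the submonoid generated by $A_i$, $i=1,2$. Then $S$ is a gluing of $S_1$ and $S_2$ (by $\delta$) if there is $\delta\in S_1\cap S_2$ with $G(S_1)\cap G(S_2)=\delta\mathbb{Z}$. *)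

theory Defs
  imports
    "HOL-Analysis.Finite_Cartesian_Product"
    "HOL-Library.Extended_Nat"
    "HOL-Library.Poly_Mapping"
    "HOL-Algebra.Module"
    "HOL-Algebra.Ideal"
begin

section \<open>Projective dimension\<close>

definition module_homs ::
  "('r, 'x) ring_scheme \<Rightarrow> ('r, 'a, 'y) module_scheme \<Rightarrow> ('r, 'b, 'z) module_scheme \<Rightarrow> ('a \<Rightarrow> 'b) set"
  where "module_homs R M N =
    {f. f \<in> carrier M \<rightarrow> carrier N \<and>
        (\<forall>x\<in>carrier M. \<forall>y\<in>carrier M. f (x \<oplus>\<^bsub>M\<^esub> y) = f x \<oplus>\<^bsub>N\<^esub> f y) \<and>
        (\<forall>r\<in>carrier R. \<forall>x\<in>carrier M. f (r \<odot>\<^bsub>M\<^esub> x) = r \<odot>\<^bsub>N\<^esub> f x)}"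

text \<open>The free \<open>R\<close>-module on the basis \<open>X\<close>: finitely supported functions \<open>X \<rightarrow> R\<close>, extended by zero
  outside \<open>X\<close>. The ring operations of the record play no role in a module.\<close>

definition free_module :: "('r, 'x) ring_scheme \<Rightarrow> 'i set \<Rightarrow> ('r, 'i \<Rightarrow> 'r) module"
  where "free_module R X =
    \<lparr>carrier = {f. (\<forall>i\<in>X. f i \<in> carrier R) \<and> (\<forall>i. i \<notin> X \<longrightarrow> f i = \<zero>\<^bsub>R\<^esub>) \<and> finite {i. f i \<noteq> \<zero>\<^bsub>R\<^esub>}},
     monoid.mult = undefined, one = undefined,
     ring.zero = (\<lambda>_. \<zero>\<^bsub>R\<^esub>), add = (\<lambda>f g i. f i \<oplus>\<^bsub>R\<^esub> g i),
     smult = (\<lambda>r f i. r \<otimes>\<^bsub>R\<^esub> f i)\<rparr>"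

text \<open>Projective modules are the direct summands of free modules. It costs no generality to take
  the basis inside the type \<open>'p\<close> of \<open>P\<close>: a projective module \<open>P\<close> is already a direct summand of the
  free module on the set \<open>carrier P\<close>.\<close>

definition projective_module :: "('r, 'x) ring_scheme \<Rightarrow> ('r, 'p, 'y) module_scheme \<Rightarrow> bool"
  where "projective_module R P \<longleftrightarrow>
    module R P \<and>
    (\<exists>(X :: 'p set) \<iota> \<pi>.
        \<iota> \<in> module_homs R P (free_module R X) \<and> \<pi> \<in> module_homs R (free_module R X) P \<and>
        (\<forall>x\<in>carrier P. \<pi> (\<iota> x) = x))"

text \<open>A projective resolution \<open>\<dots> \<rightarrow> P\<^sub>1 \<rightarrow> P\<^sub>0 \<rightarrow> M \<rightarrow> 0\<close> of length at most \<open>n\<close>, i.e. with \<open>P\<^sub>i = 0\<close> for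
  \<open>i > n\<close>; here \<open>\<epsilon>\<close> is the augmentation and \<open>d i\<close> maps \<open>P (Suc i)\<close> to \<open>P i\<close>. The terms are arbitrary
  modules with elements in the type \<open>'m \<times> 'r \<times> nat\<close>. This costs no generality: that type is infinite
  and at least as large as \<open>R\<close> and \<open>M\<close>, so if \<open>M\<close> has any projective resolution of length \<open>n\<close> (in
  any type), then it has one whose terms are that small, namely a truncated free resolution with
  the next syzygy as last term.\<close>

definition has_projective_resolution ::
  "('r, 'x) ring_scheme \<Rightarrow> ('r, 'm, 'y) module_scheme \<Rightarrow> nat \<Rightarrow> bool"
  where "has_projective_resolution R M n \<longleftrightarrow>
    (\<exists>(P :: nat \<Rightarrow> ('r, 'm \<times> 'r \<times> nat) module) d \<epsilon>.
        (\<forall>i. projective_module R (P i)) \<and>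
        (\<forall>i. d i \<in> module_homs R (P (Suc i)) (P i)) \<and>
        \<epsilon> \<in> module_homs R (P 0) M \<and>
        \<epsilon> ` carrier (P 0) = carrier M \<and>
        d 0 ` carrier (P 1) = {x \<in> carrier (P 0). \<epsilon> x = \<zero>\<^bsub>M\<^esub>} \<and>
        (\<forall>i. d (Suc i) ` carrier (P (Suc (Suc i))) =
             {x \<in> carrier (P (Suc i)). d i x = \<zero>\<^bsub>P i\<^esub>}) \<and>
        (\<forall>i>n. carrier (P i) = {\<zero>\<^bsub>P i\<^esub>}))"

text \<open>Infinite if there is no finite projective resolution. The zero module gets dimension \<open>0\<close>.\<close>

definition projective_dimension ::
  "('r, 'x) ring_scheme \<Rightarrow> ('r, 'm, 'y) module_scheme \<Rightarrow> enat"
  where "projective_dimension R M = (INF n\<in>{n. has_projective_resolution R M n}. enat n)"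


section \<open>Affine semigroups\<close>

inductive_set submonoid_gen :: "'a::comm_monoid_add set \<Rightarrow> 'a set"
  for B :: "'a set"
  where
    zero: "0 \<in> submonoid_gen B"
  | incl: "b \<in> B \<Longrightarrow> b \<in> submonoid_gen B"
  | add: "x \<in> submonoid_gen B \<Longrightarrow> y \<in> submonoid_gen B \<Longrightarrow> x + y \<in> submonoid_gen B"

definition minimal_generators :: "(nat ^ 'd) set \<Rightarrow> (nat ^ 'd) set \<Rightarrow> bool"
  where "minimal_generators B T \<longleftrightarrow>
    finite B \<and> submonoid_gen B = T \<and> (\<forall>C. C \<subset> B \<longrightarrow> submonoid_gen C \<noteq> T)"

definition int_vec :: "nat ^ 'd \<Rightarrow> int ^ 'd"
  where "int_vec a = (\<chi> i. int (a $ i))"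

definition group_of :: "(nat ^ 'd) set \<Rightarrow> (int ^ 'd) set"
  where "group_of T = {int_vec a - int_vec b | a b. a \<in> T \<and> b \<in> T}"

definition gluing :: "(nat ^ 'd) set \<Rightarrow> (nat ^ 'd) set \<Rightarrow> (nat ^ 'd) set \<Rightarrow> bool"
  where "gluing S S1 S2 \<longleftrightarrow>
    (\<exists>A A1 A2.
        minimal_generators A S \<and> A = A1 \<union> A2 \<and> A1 \<inter> A2 = {} \<and> A1 \<noteq> {} \<and> A2 \<noteq> {} \<and>
        S1 = submonoid_gen A1 \<and> S2 = submonoid_gen A2 \<and>
        (\<exists>\<delta> \<in> S1 \<inter> S2. group_of S1 \<inter> group_of S2 = {z *s int_vec \<delta> | z :: int. True}))"


section \<open>Semigroup rings and their defining ideals\<close>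

text \<open>Polynomials with coefficients in \<open>'k\<close> are finitely supported functions \<open>'e \<Rightarrow>\<^sub>0 'k\<close> on
  exponents. For the ambient ring \<open>k[t\<^sub>1,\<dots>,t\<^sub>d]\<close> the exponents are vectors in \<open>nat ^ 'd\<close>. The ring
  \<open>R = k[x\<^sub>1,\<dots>,x\<^sub>m]\<close> attached to the minimal generators \<open>B = {b\<^sub>1,\<dots>,b\<^sub>m}\<close> has one variable for
  each generator; these variables are named by the generators themselves, so that an exponent
  is a finitely supported function \<open>nat ^ 'd \<Rightarrow>\<^sub>0 nat\<close> vanishing outside \<open>B\<close>.\<close>

definition poly_ring :: "'v set \<Rightarrow> (('v \<Rightarrow>\<^sub>0 nat) \<Rightarrow>\<^sub>0 'k::field) ring"
  where "poly_ring V =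
    \<lparr>carrier = {p. \<forall>u \<in> Poly_Mapping.keys p. Poly_Mapping.keys u \<subseteq> V},
     monoid.mult = (*), one = 1, ring.zero = 0, add = (+)\<rparr>"

text \<open>The \<open>k\<close>-algebra homomorphism with \<open>x\<^sub>b \<mapsto> t\<^sup>b\<close>.\<close>

definition toric_map :: "((nat ^ 'd \<Rightarrow>\<^sub>0 nat) \<Rightarrow>\<^sub>0 'k::field) \<Rightarrow> (nat ^ 'd \<Rightarrow>\<^sub>0 'k)"
  where "toric_map p =
    (\<Sum>u \<in> Poly_Mapping.keys p.
        Poly_Mapping.single 0 (Poly_Mapping.lookup p u) *
        (\<Prod>b \<in> Poly_Mapping.keys u. Poly_Mapping.single b 1 ^ Poly_Mapping.lookup u b))"

definition toric_ideal :: "(nat ^ 'd) set \<Rightarrow> ((nat ^ 'd \<Rightarrow>\<^sub>0 nat) \<Rightarrow>\<^sub>0 'k::field) set"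
  where "toric_ideal B = {p \<in> carrier (poly_ring B). toric_map p = 0}"

text \<open>The semigroup ring \<open>k[t\<^sup>b | b \<in> B]\<close>, viewed as a module over \<open>poly_ring B\<close>.\<close>

definition semigroup_ring ::
  "(nat ^ 'd) set \<Rightarrow> ((nat ^ 'd \<Rightarrow>\<^sub>0 nat) \<Rightarrow>\<^sub>0 'k::field, nat ^ 'd \<Rightarrow>\<^sub>0 'k) module"
  where "semigroup_ring B =
    \<lparr>carrier = toric_map ` carrier (poly_ring B),
     monoid.mult = (*), one = 1, ring.zero = 0, add = (+),
     smult = (\<lambda>p f. toric_map p * f)\<rparr>"

text \<open>The condition \<open>pdim k[T] = m - 1\<close> is written \<open>pdim k[T] + 1 = m\<close> to avoid truncated
  subtraction. The type argument records the field.\<close>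

definition mpd_semigroup :: "'k::field itself \<Rightarrow> (nat ^ 'd) set \<Rightarrow> bool"
  where "mpd_semigroup _ T \<longleftrightarrow>
    (\<exists>B. minimal_generators B T \<and>
         projective_dimension
           (poly_ring B :: ((nat ^ 'd \<Rightarrow>\<^sub>0 nat) \<Rightarrow>\<^sub>0 'k) ring) (semigroup_ring B) + 1
         = enat (card B))"

definition minimal_ideal_generators :: "('r, 'x) ring_scheme \<Rightarrow> 'r set \<Rightarrow> 'r set \<Rightarrow> bool"
  where "minimal_ideal_generators R G I \<longleftrightarrow>
    G \<subseteq> carrier R \<and> Idl\<^bsub>R\<^esub> G = I \<and> (\<forall>H. H \<subset> G \<longrightarrow> Idl\<^bsub>R\<^esub> H \<noteq> I)"

definition full_support_binomial :: "'v set \<Rightarrow> (('v \<Rightarrow>\<^sub>0 nat) \<Rightarrow>\<^sub>0 'k::field) \<Rightarrow> bool"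
  where "full_support_binomial V g \<longleftrightarrow>
    (\<exists>u v. g = Poly_Mapping.single u 1 - Poly_Mapping.single v 1 \<and>
           Poly_Mapping.keys u \<union> Poly_Mapping.keys v = V)"

definition generic_ideal :: "'v set \<Rightarrow> (('v \<Rightarrow>\<^sub>0 nat) \<Rightarrow>\<^sub>0 'k::field) set \<Rightarrow> bool"
  where "generic_ideal V I \<longleftrightarrow>
    (\<exists>G. minimal_ideal_generators (poly_ring V) G I \<and> (\<forall>g\<in>G. full_support_binomial V g))"

end

theory Submission
  imports Defs
begin

text \<open>One of the two parts, say \<open>A1\<close>, has at least two elements. If the monomials in \<open>A1\<close> had pairwise
  distinct degrees, the semigroup ring of \<open>S1\<close> would be free of rank one, so \<open>S1\<close> would not have
  maximal projective dimension. Take two distinct exponents \<open>a\<close>, \<open>b\<close> on \<open>A1\<close> of minimal common degree;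
  any two exponents on \<open>A1\<close> in that degree then have disjoint supports. If \<open>I\<^sub>S\<close> is generic, some
  generator \<open>x\<^sup>u - x\<^sup>v\<close> of full support has \<open>x\<^sup>u\<close> dividing \<open>x\<^sup>a\<close>. Then \<open>v\<close> involves all of \<open>A2\<close>, and the
  gluing condition makes the degree of its \<open>A2\<close>-part a positive multiple of \<open>\<delta>\<close>. Replacing that part by
  a fixed factorization \<open>d\<close> of \<open>\<delta>\<close> in \<open>S1\<close>, together with a remainder, turns \<open>a\<close> into an exponent on \<open>A1\<close>
  of the same degree, and full support forces it to be \<open>b\<close>. So \<open>d\<close> is supported in \<open>b\<close>, by symmetry also
  in \<open>a\<close>, which contradicts disjointness.\<close>

section \<open>Generating sets of submonoids\<close>

lemma submonoid_gen_subset: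
  assumes "C \<subseteq> submonoid_gen B"
  shows "submonoid_gen C \<subseteq> submonoid_gen B"
proof
  fix x assume "x \<in> submonoid_gen C"
  then show "x \<in> submonoid_gen B"
    by induction (use assms in \<open>auto intro: submonoid_gen.intros\<close>)
qed

lemma submonoid_gen_mono:
  assumes "C \<subseteq> B"
  shows "submonoid_gen C \<subseteq> submonoid_gen B"
  using assms by (intro submonoid_gen_subset) (auto intro: submonoid_gen.incl)

lemma minimal_generators_not_redundant:
  assumes "minimal_generators B T" and "b \<in> B"
  shows "b \<notin> submonoid_gen (B - {b})"
proof
  assume "b \<in> submonoid_gen (B - {b})"
  then have "B \<subseteq> submonoid_gen (B - {b})"
    by (auto intro: submonoid_gen.incl)
  then have "submonoid_gen (B - {b}) = T"
    using assms(1) submonoid_gen_subset submonoid_gen_mono[of "B - {b}" B]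
    unfolding minimal_generators_def by blast
  moreover have "B - {b} \<subset> B" using assms(2) by blast
  ultimately show False using assms(1) unfolding minimal_generators_def by blast
qed

lemma minimal_generators_nonzero:
  assumes "minimal_generators B T" and "b \<in> B"
  shows "b \<noteq> 0"
  using minimal_generators_not_redundant[OF assms] submonoid_gen.zero by metis

text \<open>A sum of generators either avoids \<open>b\<close> or has a summand \<open>b\<close>
  that can be pulled out. This dichotomy is what irreducibility of minimal generators rests
  on.\<close>

lemma submonoid_gen_split_off:
  assumes "x \<in> submonoid_gen B"
  shows "x \<in> submonoid_gen (B - {b}) \<or> (\<exists>y \<in> submonoid_gen B. x = b + y)"
  using assms
proof induction
  case zero
  then show ?case by (simp add: submonoid_gen.zero)
next
  case (incl c)
  show ?case
  proof (cases "c = b")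
    case True
    then have "c = b + 0" by simp
    then show ?thesis using submonoid_gen.zero by blast
  next
    case False
    then show ?thesis using incl by (simp add: submonoid_gen.incl)
  qed
next
  case (add x y)
  from add.IH consider "x \<in> submonoid_gen (B - {b})" "y \<in> submonoid_gen (B - {b})"
    | x' where "x' \<in> submonoid_gen B" "x = b + x'"
    | y' where "y' \<in> submonoid_gen B" "y = b + y'" by blast
  then show ?case
  proof cases
    case 1
    then show ?thesis by (simp add: submonoid_gen.add)
  next
    case 2
    then show ?thesis using submonoid_gen.add[OF 2(1) add.hyps(2)] by (auto simp: add.assoc)
  next
    case 3
    then show ?thesis using submonoid_gen.add[OF add.hyps(1) 3(1)] by (auto simp: add.left_commute)
  qed
qed

lemma nat_vec_add_eq_0: "(x :: nat ^ 'd) + y = 0 \<longleftrightarrow> x = 0 \<and> y = 0"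
  by (auto simp: vec_eq_iff)

text \<open>A minimal generator is irreducible: \<open>\<nat>\<^sup>d\<close> has no invertible elements besides \<open>0\<close>.\<close>

lemma minimal_generator_irreducible:
  fixes B :: "(nat ^ 'd) set"
  assumes B: "minimal_generators B T" and b: "b \<in> B"
    and x: "x \<in> T" and y: "y \<in> T" and eq: "b = x + y"
  shows "x = 0 \<or> y = 0"
proof (rule ccontr)
  assume nz: "\<not> (x = 0 \<or> y = 0)"
  have T: "T = submonoid_gen B" using B by (simp add: minimal_generators_def)
  \<comment> \<open>A summand that used \<open>b\<close> itself would leave
    \<open>z + y' = 0\<close> after cancelling \<open>b\<close>. So both summands avoid
    \<open>b\<close>, and \<open>b\<close> would be redundant.\<close>
  have *: "x' \<in> submonoid_gen (B - {b})" if x': "x' \<in> T" "b = x' + y'" "y' \<noteq> 0" for x' y'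
  proof (rule ccontr)
    assume "x' \<notin> submonoid_gen (B - {b})"
    then obtain z where "x' = b + z"
      using submonoid_gen_split_off[of x' B b] x'(1) T by blast
    then have "b + 0 = b + (z + y')" using x'(2) by (metis add.assoc add_0_right)
    then have "z + y' = 0" by (simp only: add_left_cancel)
    then show False using x'(3) by (simp add: nat_vec_add_eq_0)
  qed
  have "x \<in> submonoid_gen (B - {b})"
    using *[OF x eq] nz by blast
  moreover have "y \<in> submonoid_gen (B - {b})"
    using *[OF y eq[unfolded add.commute[of x]]] nz by blast
  ultimately have "x + y \<in> submonoid_gen (B - {b})"
    by (rule submonoid_gen.add)
  then have "b \<in> submonoid_gen (B - {b})" using eq by simp
  then show False using minimal_generators_not_redundant[OF B b] by blast
qed

text \<open>An irreducible element cannot arise as a proper sum, so every generating set has to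
  contain it. Uniqueness of minimal generating sets follows.\<close>

lemma minimal_generators_subset_generators:
  fixes B :: "(nat ^ 'd) set"
  assumes B: "minimal_generators B T" and C: "submonoid_gen C = T"
  shows "B \<subseteq> C"
proof
  fix b assume b: "b \<in> B"
  have "x \<in> C" if "x \<in> submonoid_gen C" "x = b" for x
    using that
  proof induction
    case zero
    then show ?case using minimal_generators_nonzero[OF B b] by simp
  next
    case (incl c)
    then show ?case by simp
  next
    case (add x y)
    then have "x = 0 \<or> y = 0"
      using minimal_generator_irreducible[OF B b, of x y] C by simp
    then show ?case using add by auto
  qed
  moreover have "b \<in> submonoid_gen C"
    using B C submonoid_gen.incl[OF b] by (simp add: minimal_generators_def)
  ultimately show "b \<in> C" by blast
qed

lemma minimal_generators_unique:
  fixes B :: "(nat ^ 'd) set"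
  assumes "minimal_generators B T" "minimal_generators C T"
  shows "B = C"
proof (rule equalityI)
  have gen: "submonoid_gen B = T" "submonoid_gen C = T"
    using assms by (simp_all add: minimal_generators_def)
  show "B \<subseteq> C" using assms(1) gen(2) by (rule minimal_generators_subset_generators)
  show "C \<subseteq> B" using assms(2) gen(1) by (rule minimal_generators_subset_generators)
qed

text \<open>Serves to identify the part \<open>A1\<close> as the minimal generating set of the
  submonoid it generates, so that the MPD condition can be read on \<open>A1\<close>. A generator
  redundant in \<open>C\<close> would be redundant in \<open>B\<close>.\<close>

lemma minimal_generators_of_subset:
  assumes "minimal_generators B T" and "C \<subseteq> B"
  shows "minimal_generators C (submonoid_gen C)"
  unfolding minimal_generators_def
proof (intro conjI allI impI)
  show "finite C"
    using assms by (auto simp: minimal_generators_def intro: finite_subset)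
  fix D assume "D \<subset> C"
  then obtain c where c: "c \<in> C" "c \<notin> D" by blast
  then have "D \<subseteq> B - {c}" using \<open>D \<subset> C\<close> assms(2) by blast
  then have "c \<notin> submonoid_gen D"
    using minimal_generators_not_redundant[OF assms(1), of c] submonoid_gen_mono c(1) assms(2)
    by blast
  then show "submonoid_gen D \<noteq> submonoid_gen C"
    using submonoid_gen.incl[OF c(1)] by blast
qed simp


section \<open>Degrees of exponents\<close>

text \<open>The semigroup degree of the monomial with exponent \<open>u\<close>: the toric map sends
  x^u to t^(\<open>mdeg u\<close>).\<close>

definition mdeg :: "(nat ^ 'd \<Rightarrow>\<^sub>0 nat) \<Rightarrow> nat ^ 'd"
  where "mdeg u = (\<Sum>b \<in> Poly_Mapping.keys u. Poly_Mapping.lookup u b *s b)"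

lemma keys_add_nat:
  fixes u v :: "'a \<Rightarrow>\<^sub>0 nat"
  shows "Poly_Mapping.keys (u + v) = Poly_Mapping.keys u \<union> Poly_Mapping.keys v"
  by (auto simp: in_keys_iff lookup_add)

lemma mdeg_zero [simp]: "mdeg 0 = 0"
  by (simp add: mdeg_def)

lemma mdeg_add: "mdeg (u + v) = mdeg u + mdeg v"
  unfolding mdeg_def
  by (rule setsum_keys_plus_distrib[where f = "\<lambda>b n. n *s b"])
    (simp_all add: vec_eq_iff algebra_simps)

lemma mdeg_single [simp]: "mdeg (Poly_Mapping.single b n) = n *s b"
  by (cases "n = 0") (simp_all add: mdeg_def vec_eq_iff)

lemma exponent_split_off:
  fixes u :: "'a \<Rightarrow>\<^sub>0 nat"
  assumes "b \<in> Poly_Mapping.keys u"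
  shows "\<exists>u'. u = u' + Poly_Mapping.single b 1"
proof
  show "u = (u - Poly_Mapping.single b 1) + Poly_Mapping.single b 1"
    using assms
    by (intro poly_mapping_eqI) (auto simp: lookup_add lookup_minus lookup_single when_def in_keys_iff)
qed

text \<open>The grading is positive: vectors of natural numbers cannot cancel, so a single nonzero
  variable already makes the degree nonzero.\<close>

lemma mdeg_eq_0_iff:
  assumes "0 \<notin> Poly_Mapping.keys u"
  shows "mdeg u = 0 \<longleftrightarrow> u = 0"
proof
  assume "mdeg u = 0"
  show "u = 0"
  proof (rule ccontr)
    assume "u \<noteq> 0"
    then obtain b where b: "b \<in> Poly_Mapping.keys u" by fastforce
    then obtain u' where "u = u' + Poly_Mapping.single b 1"
      using exponent_split_off[OF b] by blast
    then have "mdeg u' + 1 *s b = 0" using \<open>mdeg u = 0\<close> by (simp add: mdeg_add)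
    then have "1 *s b = 0" by (simp add: nat_vec_add_eq_0)
    then have "b = 0" by (simp add: vec_eq_iff)
    then show False using b assms by simp
  qed
qed simp

lemma submonoid_gen_scale:
  fixes B :: "(nat ^ 'd) set"
  assumes "x \<in> submonoid_gen B"
  shows "n *s x \<in> submonoid_gen B"
proof (induction n)
  case 0
  have "0 *s x = 0" by (simp add: vec_eq_iff)
  then show ?case by (simp add: submonoid_gen.zero)
next
  case (Suc n)
  have "Suc n *s x = x + n *s x" by (simp add: vec_eq_iff)
  then show ?case using Suc assms by (simp add: submonoid_gen.add)
qed

lemma mdeg_in_submonoid_gen:
  assumes "Poly_Mapping.keys u \<subseteq> B"
  shows "mdeg u \<in> submonoid_gen B"
proof -
  have "(\<Sum>b \<in> K. Poly_Mapping.lookup u b *s b) \<in> submonoid_gen B" if "finite K" "K \<subseteq> B" for K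
    using that by induction (auto intro: submonoid_gen.intros submonoid_gen_scale)
  then show ?thesis using assms by (simp add: mdeg_def)
qed

lemma submonoid_gen_imp_mdeg:
  assumes "x \<in> submonoid_gen B"
  shows "\<exists>u. Poly_Mapping.keys u \<subseteq> B \<and> mdeg u = x"
  using assms
proof induction
  case zero
  show ?case by (rule exI[of _ 0]) simp
next
  case (incl b)
  then show ?case by (intro exI[of _ "Poly_Mapping.single b 1"]) (simp add: vec_eq_iff)
next
  case (add x y)
  then obtain u v where "Poly_Mapping.keys u \<subseteq> B" "mdeg u = x" "Poly_Mapping.keys v \<subseteq> B" "mdeg v = y"
    by blast
  then show ?case by (intro exI[of _ "u + v"]) (simp add: keys_add_nat mdeg_add)
qed


section \<open>The polynomial ring and the toric map\<close>

lemma poly_ring_simps [simp]: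
  "p \<in> carrier (poly_ring V) \<longleftrightarrow> (\<forall>u \<in> Poly_Mapping.keys p. Poly_Mapping.keys u \<subseteq> V)"
  "p \<otimes>\<^bsub>poly_ring V\<^esub> q = p * q"
  "p \<oplus>\<^bsub>poly_ring V\<^esub> q = p + q"
  "\<zero>\<^bsub>poly_ring V\<^esub> = 0"
  "\<one>\<^bsub>poly_ring V\<^esub> = 1"
  by (simp_all add: poly_ring_def)

lemma cring_poly_ring: "cring (poly_ring V :: (('v \<Rightarrow>\<^sub>0 nat) \<Rightarrow>\<^sub>0 'k::field) ring)"
proof (rule cringI)
  let ?R = "poly_ring V :: (('v \<Rightarrow>\<^sub>0 nat) \<Rightarrow>\<^sub>0 'k) ring"
  show "abelian_group ?R"
  proof (rule abelian_groupI)
    fix p q assume "p \<in> carrier ?R" "q \<in> carrier ?R"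
    then show "p \<oplus>\<^bsub>?R\<^esub> q \<in> carrier ?R" using keys_add[of p q] by fastforce
  next
    fix p assume "p \<in> carrier ?R"
    then show "\<exists>q \<in> carrier ?R. q \<oplus>\<^bsub>?R\<^esub> p = \<zero>\<^bsub>?R\<^esub>"
      by (intro bexI[of _ "- p"]) simp_all
  qed (simp_all add: ac_simps)
  show "comm_monoid ?R"
  proof (rule comm_monoidI)
    fix p q assume "p \<in> carrier ?R" "q \<in> carrier ?R"
    then show "p \<otimes>\<^bsub>?R\<^esub> q \<in> carrier ?R"
      using keys_mult[of p q] by (fastforce simp: keys_add_nat)
  qed (simp_all add: ac_simps)
qed (simp add: distrib_right)

text \<open>The powers of the t^b multiply to one monomial because exponents add. Later computations
  use this form.\<close>

lemma toric_map_altdef: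
  "toric_map p = (\<Sum>u \<in> Poly_Mapping.keys p. Poly_Mapping.single (mdeg u) (Poly_Mapping.lookup p u))"
proof -
  have pow: "Poly_Mapping.single b 1 ^ n = (Poly_Mapping.single (n *s b) 1 :: nat ^ 'a \<Rightarrow>\<^sub>0 'b)" for b n
  proof (induction n)
    case 0
    have "0 *s b = 0" by (simp add: vec_eq_iff)
    then show ?case by simp
  next
    case (Suc n)
    have "Suc n *s b = b + n *s b" by (simp add: vec_eq_iff)
    then show ?case using Suc by (simp add: mult_single)
  qed
  have "(\<Prod>b \<in> K. Poly_Mapping.single b 1 ^ Poly_Mapping.lookup u b) =
      (Poly_Mapping.single (\<Sum>b \<in> K. Poly_Mapping.lookup u b *s b) 1 :: nat ^ 'a \<Rightarrow>\<^sub>0 'b)"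
    if "finite K" for K u
    using that by induction (simp_all add: pow mult_single)
  then show ?thesis by (simp add: toric_map_def mdeg_def mult_single)
qed

lemma toric_map_zero [simp]: "toric_map 0 = 0"
  by (simp add: toric_map_def)

lemma toric_map_single [simp]:
  "toric_map (Poly_Mapping.single u c) = Poly_Mapping.single (mdeg u) c"
  by (simp add: toric_map_altdef)

lemma toric_map_add: "toric_map (p + q) = toric_map p + toric_map q"
  unfolding toric_map_altdef
  by (rule setsum_keys_plus_distrib[where f = "\<lambda>u c. Poly_Mapping.single (mdeg u) c"])
    (simp_all add: single_add)

lemma toric_map_diff: "toric_map (p - q) = toric_map p - toric_map q"
  using toric_map_add[of "p - q" q] by simp

lemma toric_map_sum: "toric_map (\<Sum>i \<in> I. f i) = (\<Sum>i \<in> I. toric_map (f i))"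
  by (induction I rule: infinite_finite_induct) (simp_all add: toric_map_add)

lemma poly_mapping_eq_sum_single:
  "p = (\<Sum>u \<in> Poly_Mapping.keys p. Poly_Mapping.single u (Poly_Mapping.lookup p u))"
  by (rule poly_mapping_eqI) (auto simp: lookup_sum lookup_single when_def in_keys_iff)

text \<open>Expanding both factors into monomials reduces multiplicativity to additivity of
  \<open>mdeg\<close>.\<close>

lemma toric_map_mult: "toric_map (p * q) = toric_map p * toric_map q"
proof -
  have "p * q = (\<Sum>u \<in> Poly_Mapping.keys p. \<Sum>v \<in> Poly_Mapping.keys q.
      Poly_Mapping.single (u + v) (Poly_Mapping.lookup p u * Poly_Mapping.lookup q v))"
    by (subst (1) poly_mapping_eq_sum_single[of p], subst (1) poly_mapping_eq_sum_single[of q])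
      (simp add: sum_product mult_single)
  then have "toric_map (p * q) = (\<Sum>u \<in> Poly_Mapping.keys p. \<Sum>v \<in> Poly_Mapping.keys q.
      Poly_Mapping.single (mdeg u + mdeg v) (Poly_Mapping.lookup p u * Poly_Mapping.lookup q v))"
    by (simp add: toric_map_sum mdeg_add)
  also have "\<dots> = toric_map p * toric_map q"
    by (simp add: toric_map_altdef sum_product mult_single)
  finally show ?thesis .
qed

lemma binomial_in_toric_ideal_iff:
  assumes "Poly_Mapping.keys u \<subseteq> B" "Poly_Mapping.keys v \<subseteq> B"
  shows "(Poly_Mapping.single u 1 - Poly_Mapping.single v 1 ::
      (nat ^ 'd \<Rightarrow>\<^sub>0 nat) \<Rightarrow>\<^sub>0 'k::field) \<in> toric_ideal B \<longleftrightarrow> mdeg u = mdeg v"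
proof -
  have "Poly_Mapping.keys (Poly_Mapping.single u 1 - Poly_Mapping.single v (1::'k)) \<subseteq> {u, v}"
    using keys_diff[of "Poly_Mapping.single u (1::'k)" "Poly_Mapping.single v 1"] by auto
  moreover have "Poly_Mapping.single x 1 = Poly_Mapping.single y (1::'k) \<longleftrightarrow> x = y" for x y :: "nat ^ 'd"
    by (metis lookup_single_eq lookup_single_not_eq zero_neq_one)
  ultimately show ?thesis
    using assms by (auto simp: toric_ideal_def toric_map_diff)
qed

text \<open>If no two monomials share a degree, nothing can cancel in the image: the coefficient of
  \<open>p\<close> at \<open>u\<close> reappears as the coefficient of its image at
  \<open>mdeg u\<close>.\<close>

lemma toric_map_inj_on:
  fixes B :: "(nat ^ 'd) set"
  assumes "inj_on mdeg {u. Poly_Mapping.keys u \<subseteq> B}"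
  shows "inj_on toric_map (carrier (poly_ring B :: ((nat ^ 'd \<Rightarrow>\<^sub>0 nat) \<Rightarrow>\<^sub>0 'k::field) ring))"
proof -
  have coeff: "Poly_Mapping.lookup (toric_map p) (mdeg u) = Poly_Mapping.lookup p u"
    if p: "p \<in> carrier (poly_ring B)" and u: "Poly_Mapping.keys u \<subseteq> B"
    for p :: "(nat ^ 'd \<Rightarrow>\<^sub>0 nat) \<Rightarrow>\<^sub>0 'k" and u
  proof -
    have "mdeg v = mdeg u \<longleftrightarrow> v = u" if "v \<in> Poly_Mapping.keys p" for v
      using assms p u that by (auto simp: inj_on_def)
    then have "Poly_Mapping.lookup (toric_map p) (mdeg u) =
        (\<Sum>v \<in> Poly_Mapping.keys p. if v = u then Poly_Mapping.lookup p u else 0)"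
      unfolding toric_map_altdef lookup_sum
      by (intro sum.cong) (auto simp: lookup_single when_def)
    then show ?thesis by (auto simp: in_keys_iff)
  qed
  show ?thesis
  proof (rule inj_onI)
    fix p q :: "(nat ^ 'd \<Rightarrow>\<^sub>0 nat) \<Rightarrow>\<^sub>0 'k"
    assume pq: "p \<in> carrier (poly_ring B)" "q \<in> carrier (poly_ring B)" "toric_map p = toric_map q"
    show "p = q"
    proof (rule poly_mapping_eqI)
      fix u
      show "Poly_Mapping.lookup p u = Poly_Mapping.lookup q u"
      proof (cases "Poly_Mapping.keys u \<subseteq> B")
        case True
        then show ?thesis using coeff pq by metis
      next
        case False
        then have "u \<notin> Poly_Mapping.keys p" "u \<notin> Poly_Mapping.keys q" using pq by auto
        then show ?thesis by (simp add: in_keys_iff)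
      qed
    qed
  qed
qed


section \<open>Projective dimension of a free module of rank one\<close>

text \<open>An ideal is a module over its ring, and the bijection carries this structure over. It is
  applied to the unit ideal and the zero ideal, which give the terms of the resolution
  below.\<close>

lemma module_transport:
  assumes R: "cring R" and bij: "bij_betw \<phi> I (carrier P)" and I: "ideal I R"
    and zero: "\<zero>\<^bsub>P\<^esub> = \<phi> \<zero>\<^bsub>R\<^esub>"
    and add: "\<And>x y. x \<in> I \<Longrightarrow> y \<in> I \<Longrightarrow> \<phi> x \<oplus>\<^bsub>P\<^esub> \<phi> y = \<phi> (x \<oplus>\<^bsub>R\<^esub> y)"
    and smult: "\<And>r x. r \<in> carrier R \<Longrightarrow> x \<in> I \<Longrightarrow> r \<odot>\<^bsub>P\<^esub> \<phi> x = \<phi> (r \<otimes>\<^bsub>R\<^esub> x)"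
  shows "module R P"
proof -
  interpret cring R by fact
  interpret ideal I R by fact
  have car: "carrier P = \<phi> ` I" using bij by (simp add: bij_betw_def)
  have sub: "x \<in> carrier R" if "x \<in> I" for x using that by (rule Icarr)
  note closed = I_l_closed a_closed additive_subgroup.zero_closed[OF is_additive_subgroup]
  show ?thesis
  proof (rule moduleI)
    show "abelian_group P"
    proof (rule abelian_groupI)
      fix x assume "x \<in> carrier P"
      then obtain r where r: "r \<in> I" "x = \<phi> r" by (auto simp: car)
      then have "\<ominus>\<^bsub>R\<^esub> r \<in> I" by (simp add: a_inv_closed)
      then show "\<exists>y \<in> carrier P. y \<oplus>\<^bsub>P\<^esub> x = \<zero>\<^bsub>P\<^esub>"
        using r by (intro bexI[of _ "\<phi> (\<ominus>\<^bsub>R\<^esub> r)"]) (auto simp: car add zero sub l_neg)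
    qed (auto simp: car zero add closed sub a_ac)
  qed (use R in \<open>auto simp: car smult add closed sub l_distr r_distr m_assoc\<close>)
qed

text \<open>The bijection makes \<open>M\<close> a copy of \<open>R\<close>, so \<open>R\<close> in
  position 0 followed by zero modules resolves \<open>M\<close>.\<close>

lemma projective_dimension_free_rank_one:
  fixes R :: "('r, 'x) ring_scheme" and M :: "('r, 'm, 'y) module_scheme"
  assumes R: "cring R" and bij: "bij_betw \<phi> (carrier R) (carrier M)"
    and zero: "\<phi> \<zero>\<^bsub>R\<^esub> = \<zero>\<^bsub>M\<^esub>"
    and add: "\<And>r s. r \<in> carrier R \<Longrightarrow> s \<in> carrier R \<Longrightarrow> \<phi> (r \<oplus>\<^bsub>R\<^esub> s) = \<phi> r \<oplus>\<^bsub>M\<^esub> \<phi> s"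
    and smult: "\<And>r s. r \<in> carrier R \<Longrightarrow> s \<in> carrier R \<Longrightarrow> \<phi> (r \<otimes>\<^bsub>R\<^esub> s) = r \<odot>\<^bsub>M\<^esub> \<phi> s"
  shows "projective_dimension R M = 0"
proof -
  interpret cring R by fact
  \<comment> \<open>The terms of a resolution must have elements in this product type. Hence
    \<open>R\<close> is embedded into its middle component, and \<open>Q I\<close> is the ideal
    \<open>I\<close> carried along.\<close>
  define tag :: "'r \<Rightarrow> 'm \<times> 'r \<times> nat" where "tag r = (undefined, r, 0)" for r
  define untag :: "'m \<times> 'r \<times> nat \<Rightarrow> 'r" where "untag x = fst (snd x)" for x
  have untag_tag [simp]: "untag (tag r) = r" for r by (simp add: tag_def untag_def)
  define Q :: "'r set \<Rightarrow> ('r, 'm \<times> 'r \<times> nat) module" where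
    "Q I = \<lparr>carrier = tag ` I, monoid.mult = undefined, one = undefined,
       ring.zero = tag \<zero>\<^bsub>R\<^esub>, add = (\<lambda>x y. tag (untag x \<oplus>\<^bsub>R\<^esub> untag y)),
       smult = (\<lambda>r x. tag (r \<otimes>\<^bsub>R\<^esub> untag x))\<rparr>" for I
  have Q [simp]: "carrier (Q I) = tag ` I" "\<zero>\<^bsub>Q I\<^esub> = tag \<zero>\<^bsub>R\<^esub>"
    "x \<oplus>\<^bsub>Q I\<^esub> y = tag (untag x \<oplus>\<^bsub>R\<^esub> untag y)" "r \<odot>\<^bsub>Q I\<^esub> x = tag (r \<otimes>\<^bsub>R\<^esub> untag x)" for I x y r
    by (simp_all add: Q_def)
  have module_Q: "module R (Q I)" if "ideal I R" for I
    using that by (intro module_transport[OF R, of tag I])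
      (auto simp: bij_betw_def inj_on_def tag_def untag_def)
  have proj_R: "projective_module R (Q (carrier R))"
    unfolding projective_module_def
  proof (intro conjI exI ballI)
    \<comment> \<open>A basis with one point; \<open>undefined\<close> is merely some element of the
      required type.\<close>
    let ?F = "free_module R {undefined :: 'm \<times> 'r \<times> nat}"
    let ?\<iota> = "\<lambda>x i. if i = undefined then untag x else \<zero>\<^bsub>R\<^esub>"
    let ?\<pi> = "\<lambda>f. tag (f undefined)"
    show "module R (Q (carrier R))" by (rule module_Q) (rule oneideal)
    show "?\<iota> \<in> module_homs R (Q (carrier R)) ?F"
      by (auto simp: module_homs_def free_module_def fun_eq_iff
          intro: finite_subset[of _ "{undefined}"])
    show "?\<pi> \<in> module_homs R ?F (Q (carrier R))"
      by (auto simp: module_homs_def free_module_def)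
    show "?\<pi> (?\<iota> x) = x" if "x \<in> carrier (Q (carrier R))" for x
      using that by auto
  qed
  have proj_0: "projective_module R (Q {\<zero>\<^bsub>R\<^esub>})"
    unfolding projective_module_def
  proof (intro conjI exI ballI)
    let ?F = "free_module R ({} :: ('m \<times> 'r \<times> nat) set)"
    show "module R (Q {\<zero>\<^bsub>R\<^esub>})" by (rule module_Q) (rule zeroideal)
    show "(\<lambda>x i. \<zero>\<^bsub>R\<^esub>) \<in> module_homs R (Q {\<zero>\<^bsub>R\<^esub>}) ?F"
      by (auto simp: module_homs_def free_module_def)
    show "(\<lambda>f. tag \<zero>\<^bsub>R\<^esub>) \<in> module_homs R ?F (Q {\<zero>\<^bsub>R\<^esub>})"
      by (auto simp: module_homs_def)
    show "tag \<zero>\<^bsub>R\<^esub> = x" if "x \<in> carrier (Q {\<zero>\<^bsub>R\<^esub>})" for x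
      using that by auto
  qed
  \<comment> \<open>All differentials are zero; exactness in position 0 is the injectivity of
    \<open>\<phi>\<close>.\<close>
  define P :: "nat \<Rightarrow> ('r, 'm \<times> 'r \<times> nat) module" where
    "P i = Q (if i = 0 then carrier R else {\<zero>\<^bsub>R\<^esub>})" for i
  have inj: "\<phi> r = \<zero>\<^bsub>M\<^esub> \<longleftrightarrow> r = \<zero>\<^bsub>R\<^esub>" if "r \<in> carrier R" for r
    using bij zero that unfolding bij_betw_def inj_on_def by (metis zero_closed)
  have im: "\<phi> ` carrier R = carrier M" using bij by (simp add: bij_betw_def)
  have "has_projective_resolution R M 0"
    unfolding has_projective_resolution_def
  proof (intro exI conjI allI impI)
    show "projective_module R (P i)" for i
      using proj_R proj_0 by (simp add: P_def)
    show "(\<lambda>x. tag \<zero>\<^bsub>R\<^esub>) \<in> module_homs R (P (Suc i)) (P i)" for i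
      by (auto simp: module_homs_def P_def)
    show "(\<lambda>x. \<phi> (untag x)) \<in> module_homs R (P 0) M"
      using im by (auto simp: module_homs_def P_def add smult)
    show "(\<lambda>x. \<phi> (untag x)) ` carrier (P 0) = carrier M"
      using im by (simp add: P_def image_image)
    show "(\<lambda>x. tag \<zero>\<^bsub>R\<^esub>) ` carrier (P 1) = {x \<in> carrier (P 0). \<phi> (untag x) = \<zero>\<^bsub>M\<^esub>}"
      by (auto simp: P_def inj)
    show "(\<lambda>x. tag \<zero>\<^bsub>R\<^esub>) ` carrier (P (Suc (Suc i))) =
        {x \<in> carrier (P (Suc i)). tag \<zero>\<^bsub>R\<^esub> = \<zero>\<^bsub>P i\<^esub>}" for i
      by (auto simp: P_def)
    show "carrier (P i) = {\<zero>\<^bsub>P i\<^esub>}" if "0 < i" for i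
      using that by (simp add: P_def)
  qed
  then have "projective_dimension R M \<le> enat 0"
    unfolding projective_dimension_def by (intro INF_lower) simp
  then show ?thesis by (simp add: zero_enat_def[symmetric])
qed

text \<open>This is where the MPD condition enters. Without a relation the semigroup ring would be
  free of rank one, its projective dimension would be 0, and the MPD equation would force
  \<open>card B = 1\<close>.\<close>

lemma mpd_semigroup_relation:
  fixes B :: "(nat ^ 'd) set"
  assumes mpd: "mpd_semigroup TYPE('k::field) T" and B: "minimal_generators B T" and card: "card B \<noteq> 1"
  shows "\<not> inj_on mdeg {u. Poly_Mapping.keys u \<subseteq> B}"
proof
  let ?R = "poly_ring B :: ((nat ^ 'd \<Rightarrow>\<^sub>0 nat) \<Rightarrow>\<^sub>0 'k) ring"
  assume "inj_on mdeg {u. Poly_Mapping.keys u \<subseteq> B}"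
  then have "bij_betw toric_map (carrier ?R) (carrier (semigroup_ring B))"
    by (simp add: bij_betw_def toric_map_inj_on semigroup_ring_def del: poly_ring_simps(1))
  then have "projective_dimension ?R (semigroup_ring B) = 0"
    by (rule projective_dimension_free_rank_one[OF cring_poly_ring])
      (simp_all add: semigroup_ring_def toric_map_add toric_map_mult)
  \<comment> \<open>The generating set hidden in \<open>mpd_semigroup\<close> is \<open>B\<close> by
    uniqueness.\<close>
  moreover have "projective_dimension ?R (semigroup_ring B) + 1 = enat (card B)"
    using mpd minimal_generators_unique[OF B] by (auto simp: mpd_semigroup_def)
  ultimately show False using card by (simp add: one_enat_def)
qed


section \<open>Generic ideals and gluings\<close>

text \<open>The polynomials none of whose monomials divides x^a form an ideal \<open>?J\<close>,
  since a multiple of a non-divisor is a non-divisor. If \<open>G\<close> lay inside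
  \<open>?J\<close>, so would \<open>p\<close>, yet x^a occurs in \<open>p\<close> and divides
  itself.\<close>

lemma generated_ideal_divisor:
  fixes G :: "(('v \<Rightarrow>\<^sub>0 nat) \<Rightarrow>\<^sub>0 'k::field) set"
  assumes G: "G \<subseteq> carrier (poly_ring V)" and p: "p \<in> Idl\<^bsub>poly_ring V\<^esub> G" and a: "a \<in> Poly_Mapping.keys p"
  shows "\<exists>g \<in> G. \<exists>u \<in> Poly_Mapping.keys g. \<exists>w. a = w + u"
proof (rule ccontr)
  let ?R = "poly_ring V :: (('v \<Rightarrow>\<^sub>0 nat) \<Rightarrow>\<^sub>0 'k) ring"
  let ?J = "{q \<in> carrier ?R. \<forall>u \<in> Poly_Mapping.keys q. \<nexists>w. a = w + u}"
  interpret cring ?R by (rule cring_poly_ring)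
  assume "\<not> ?thesis"
  then have "G \<subseteq> ?J" using G by blast
  moreover have "ideal ?J ?R"
  proof (rule idealI)
    show "subgroup ?J (add_monoid ?R)"
    proof (rule add.subgroupI)
      fix q assume q: "q \<in> ?J"
      then have "q \<in> carrier ?R" by simp
      then have "\<ominus>\<^bsub>?R\<^esub> q = - q"
        by (intro minus_equality) simp_all
      then show "\<ominus>\<^bsub>?R\<^esub> q \<in> ?J" using q by simp
    next
      fix q r assume "q \<in> ?J" "r \<in> ?J"
      then show "q \<oplus>\<^bsub>?R\<^esub> r \<in> ?J" using keys_add[of q r] by fastforce
    qed (auto intro: exI[of _ 0])
  next
    fix q r assume q: "q \<in> ?J" and r: "r \<in> carrier ?R"
    have "r \<otimes>\<^bsub>?R\<^esub> q \<in> carrier ?R" using q r by (intro m_closed) auto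
    moreover have "\<nexists>w. a = w + u" if u: "u \<in> Poly_Mapping.keys (r * q)" for u
    proof
      assume "\<exists>w. a = w + u"
      then obtain w where w: "a = w + u" by blast
      obtain s t where "u = s + t" "t \<in> Poly_Mapping.keys q" using keys_mult[of r q] u by blast
      then show False using q w by (auto simp: add.assoc[symmetric])
    qed
    ultimately show "r \<otimes>\<^bsub>?R\<^esub> q \<in> ?J" by simp
    then show "q \<otimes>\<^bsub>?R\<^esub> r \<in> ?J" by (simp add: mult.commute)
  qed (rule ring_axioms)
  ultimately have "p \<in> ?J" using genideal_minimal p by blast
  then have "\<nexists>w. a = w + a" using a by blast
  then show False by (metis add_0)
qed

text \<open>The binomial x^a - x^b lies in the ideal, so some generator has a monomial dividing x^a.
  That monomial is called x^u and the other one x^v, whichever sign they carry.\<close>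

lemma generic_toric_ideal_divisor:
  fixes B :: "(nat ^ 'd) set"
  assumes gen: "generic_ideal B (toric_ideal B :: ((nat ^ 'd \<Rightarrow>\<^sub>0 nat) \<Rightarrow>\<^sub>0 'k::field) set)"
    and a: "Poly_Mapping.keys a \<subseteq> B" and b: "Poly_Mapping.keys b \<subseteq> B"
    and "a \<noteq> b" and "mdeg a = mdeg b"
  shows "\<exists>u v w. a = w + u \<and> u \<noteq> v \<and> mdeg u = mdeg v \<and>
    Poly_Mapping.keys u \<union> Poly_Mapping.keys v = B"
proof -
  let ?R = "poly_ring B :: ((nat ^ 'd \<Rightarrow>\<^sub>0 nat) \<Rightarrow>\<^sub>0 'k) ring"
  have "ring ?R" by (rule cring.axioms(1)) (rule cring_poly_ring)
  obtain G where "minimal_ideal_generators ?R G (toric_ideal B)"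
    and full: "\<forall>g\<in>G. full_support_binomial B g"
    using gen unfolding generic_ideal_def by (elim exE conjE)
  then have G: "G \<subseteq> carrier ?R" "Idl\<^bsub>?R\<^esub> G = toric_ideal B"
    unfolding minimal_ideal_generators_def by simp_all
  let ?p = "Poly_Mapping.single a 1 - Poly_Mapping.single b (1 :: 'k)"
  have "?p \<in> Idl\<^bsub>?R\<^esub> G"
    using G(2) binomial_in_toric_ideal_iff[OF a b] \<open>mdeg a = mdeg b\<close> by blast
  moreover have "a \<in> Poly_Mapping.keys ?p"
    using \<open>a \<noteq> b\<close> by (simp add: in_keys_iff lookup_minus lookup_single)
  ultimately obtain g u w where g: "g \<in> G" "u \<in> Poly_Mapping.keys g" "a = w + u"
    using generated_ideal_divisor[OF G(1), of ?p a] by blast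
  obtain s t where st: "g = Poly_Mapping.single s 1 - Poly_Mapping.single t 1"
    "Poly_Mapping.keys s \<union> Poly_Mapping.keys t = B"
    using bspec[OF full g(1)] unfolding full_support_binomial_def by (elim exE conjE)
  have "g \<in> toric_ideal B" using ring.genideal_self[OF \<open>ring ?R\<close> G(1)] G(2) g(1) by blast
  then have "mdeg s = mdeg t" using binomial_in_toric_ideal_iff[of s B t] st by blast
  moreover have "s \<noteq> t" using g(2) st(1) by auto
  moreover have "u = s \<or> u = t"
    using g(2) st(1) keys_diff[of "Poly_Mapping.single s (1::'k)" "Poly_Mapping.single t 1"] by auto
  ultimately show ?thesis using g(3) st(2) by (metis Un_commute)
qed

lemma exponent_split_support:
  fixes v :: "'a \<Rightarrow>\<^sub>0 nat"
  assumes "Poly_Mapping.keys v \<subseteq> A1 \<union> A2" and "A1 \<inter> A2 = {}"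
  shows "\<exists>v1 v2. v = v1 + v2 \<and> Poly_Mapping.keys v1 = Poly_Mapping.keys v \<inter> A1 \<and>
    Poly_Mapping.keys v2 = Poly_Mapping.keys v \<inter> A2"
proof -
  define r where "r X = Abs_poly_mapping (\<lambda>b. Poly_Mapping.lookup v b when b \<in> X)" for X
  have lookup_r: "Poly_Mapping.lookup (r X) b = (Poly_Mapping.lookup v b when b \<in> X)" for X b
  proof -
    have "finite {b. (Poly_Mapping.lookup v b when b \<in> X) \<noteq> 0}"
      by (rule finite_subset[of _ "Poly_Mapping.keys v"]) (auto simp: in_keys_iff when_def)
    then show ?thesis by (simp add: r_def)
  qed
  have "v = r A1 + r A2"
    using assms by (intro poly_mapping_eqI) (auto simp: lookup_add lookup_r when_def in_keys_iff)
  moreover have "Poly_Mapping.keys (r X) = Poly_Mapping.keys v \<inter> X" for X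
    by (auto simp: in_keys_iff lookup_r when_def split: if_splits)
  ultimately show ?thesis by blast
qed

text \<open>The degree of \<open>v2\<close> lies in both groups, as \<open>mdeg u\<close> minus
  \<open>mdeg v1\<close> and as \<open>mdeg v2\<close> minus 0, so it is a multiple of
  \<open>\<delta>\<close>. Being nonzero with nonnegative entries, it is a positive multiple and can
  be rewritten with generators from \<open>A1\<close>.\<close>

lemma gluing_degree_exchange:
  fixes A1 A2 :: "(nat ^ 'd) set"
  assumes group: "group_of (submonoid_gen A1) \<inter> group_of (submonoid_gen A2) =
      {z *s int_vec \<delta> | z :: int. True}"
    and d: "Poly_Mapping.keys d \<subseteq> A1" "mdeg d = \<delta>"
    and u: "Poly_Mapping.keys u \<subseteq> A1" and v1: "Poly_Mapping.keys v1 \<subseteq> A1"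
    and v2: "Poly_Mapping.keys v2 \<subseteq> A2" "mdeg v2 \<noteq> 0"
    and eq: "mdeg u = mdeg v1 + mdeg v2"
  shows "\<exists>e. Poly_Mapping.keys e \<subseteq> A1 \<and> mdeg v2 = mdeg d + mdeg e \<and> \<delta> \<noteq> 0"
proof -
  have "int_vec (mdeg v2) = int_vec (mdeg u) - int_vec (mdeg v1)"
    by (simp add: eq int_vec_def vec_eq_iff)
  then have "int_vec (mdeg v2) \<in> group_of (submonoid_gen A1)"
    using u v1 mdeg_in_submonoid_gen unfolding group_of_def by blast
  moreover have "int_vec (mdeg v2) = int_vec (mdeg v2) - int_vec 0"
    by (simp add: int_vec_def vec_eq_iff)
  then have "int_vec (mdeg v2) \<in> group_of (submonoid_gen A2)"
    using v2 mdeg_in_submonoid_gen submonoid_gen.zero unfolding group_of_def by blast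
  ultimately obtain z where z: "int_vec (mdeg v2) = z *s int_vec \<delta>" using group by blast
  then have comp: "int (mdeg v2 $ i) = z * int (\<delta> $ i)" for i
    by (simp add: int_vec_def vec_eq_iff)
  obtain i where i: "mdeg v2 $ i \<noteq> 0" using v2(2) by (auto simp: vec_eq_iff)
  have "0 < z * int (\<delta> $ i)" using comp[of i] i by linarith
  then have "z > 0" by (simp add: zero_less_mult_iff)
  \<comment> \<open>One copy of \<open>\<delta>\<close> is set aside for \<open>d\<close>; the
    remaining \<open>m = z - 1\<close> copies are factored in \<open>A1\<close> and yield
    \<open>e\<close>.\<close>
  then obtain m where m: "z = 1 + int m" using zless_iff_Suc_zadd[of 0 z] by auto
  have "mdeg v2 $ i = \<delta> $ i + m * \<delta> $ i" for i
  proof -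
    have "int (mdeg v2 $ i) = int (\<delta> $ i + m * \<delta> $ i)"
      using comp[of i] by (simp add: m algebra_simps)
    then show ?thesis by linarith
  qed
  then have "mdeg v2 = \<delta> + m *s \<delta>" by (simp add: vec_eq_iff)
  moreover have "m *s \<delta> \<in> submonoid_gen A1"
    using d mdeg_in_submonoid_gen submonoid_gen_scale by blast
  moreover have "\<delta> \<noteq> 0" using comp[of i] i by auto
  ultimately show ?thesis using submonoid_gen_imp_mdeg d(2) by metis
qed

text \<open>A variable shared by two exponents of the same degree could be cancelled from both,
  leaving a relation in a smaller degree.\<close>

lemma minimal_relation:
  fixes B :: "(nat ^ 'd) set"
  assumes B: "0 \<notin> B" and rel: "\<not> inj_on mdeg {u. Poly_Mapping.keys u \<subseteq> B}"
  obtains a b where "Poly_Mapping.keys a \<subseteq> B" "Poly_Mapping.keys b \<subseteq> B" "a \<noteq> b" "mdeg a = mdeg b"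
    "\<And>c c'. Poly_Mapping.keys c \<subseteq> B \<Longrightarrow> Poly_Mapping.keys c' \<subseteq> B \<Longrightarrow> c \<noteq> c' \<Longrightarrow>
       mdeg c = mdeg a \<Longrightarrow> mdeg c' = mdeg a \<Longrightarrow> Poly_Mapping.keys c \<inter> Poly_Mapping.keys c' = {}"
proof -
  \<comment> \<open>The size depends on the degree alone, so minimality of \<open>a\<close> bounds
    every exponent in the degree of \<open>a\<close>. Cancelling a nonzero \<open>x\<close> strictly
    lowers it.\<close>
  define size where "size u = (\<Sum>i\<in>UNIV. mdeg u $ i)" for u :: "nat ^ 'd \<Rightarrow>\<^sub>0 nat"
  define Rel where "Rel a \<longleftrightarrow> Poly_Mapping.keys a \<subseteq> B \<and>
    (\<exists>b. Poly_Mapping.keys b \<subseteq> B \<and> a \<noteq> b \<and> mdeg a = mdeg b)" for a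
  have "\<exists>a. Rel a" using rel by (auto simp: inj_on_def Rel_def)
  then obtain a where a: "Rel a" and min: "\<And>c. Rel c \<Longrightarrow> size a \<le> size c"
    using exists_least_iff[of "\<lambda>n. \<exists>a. Rel a \<and> size a = n"] by (metis not_le)
  then obtain b where b: "Poly_Mapping.keys a \<subseteq> B" "Poly_Mapping.keys b \<subseteq> B" "a \<noteq> b" "mdeg a = mdeg b"
    by (auto simp: Rel_def)
  have "Poly_Mapping.keys c \<inter> Poly_Mapping.keys c' = {}"
    if c: "Poly_Mapping.keys c \<subseteq> B" "Poly_Mapping.keys c' \<subseteq> B" "c \<noteq> c'"
      "mdeg c = mdeg a" "mdeg c' = mdeg a" for c c'
  proof (rule ccontr)
    assume "Poly_Mapping.keys c \<inter> Poly_Mapping.keys c' \<noteq> {}"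
    then obtain x where x: "x \<in> Poly_Mapping.keys c" "x \<in> Poly_Mapping.keys c'" by blast
    then obtain s t where st: "c = s + Poly_Mapping.single x 1" "c' = t + Poly_Mapping.single x 1"
      using exponent_split_off[OF x(1)] exponent_split_off[OF x(2)] by blast
    have "mdeg s + 1 *s x = mdeg t + 1 *s x" using c(4,5) st by (simp add: mdeg_add)
    then have "mdeg s = mdeg t" by (simp only: add_right_cancel)
    then have "Rel s"
      using c st by (auto simp: Rel_def keys_add_nat intro!: exI[of _ t])
    then have "size a \<le> size s" by (rule min)
    moreover have "size a = size s + (\<Sum>i\<in>UNIV. x $ i)"
      unfolding size_def c(4)[symmetric] st(1) by (simp add: mdeg_add sum.distrib)
    ultimately have "(\<Sum>i\<in>UNIV. x $ i) = 0" by simp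
    then have "x = 0" by (simp add: vec_eq_iff)
    then show False using x c B by blast
  qed
  then show ?thesis using that b by blast
qed

text \<open>The argument is asymmetric in the two parts: the relation lives on \<open>A1\<close>,
  and \<open>A2\<close> only has to be nonempty.\<close>

lemma gluing_not_generic:
  fixes A1 A2 :: "(nat ^ 'd) set"
  assumes A: "minimal_generators (A1 \<union> A2) S" and disj: "A1 \<inter> A2 = {}" and ne: "A2 \<noteq> {}"
    and \<delta>: "\<delta> \<in> submonoid_gen A1"
    and group: "group_of (submonoid_gen A1) \<inter> group_of (submonoid_gen A2) =
      {z *s int_vec \<delta> | z :: int. True}"
    and mpd: "mpd_semigroup TYPE('k::field) (submonoid_gen A1)" and card: "card A1 \<noteq> 1"
  shows "\<not> generic_ideal (A1 \<union> A2) (toric_ideal (A1 \<union> A2) :: ((nat ^ 'd \<Rightarrow>\<^sub>0 nat) \<Rightarrow>\<^sub>0 'k) set)"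
proof
  assume gen: "generic_ideal (A1 \<union> A2) (toric_ideal (A1 \<union> A2) :: ((nat ^ 'd \<Rightarrow>\<^sub>0 nat) \<Rightarrow>\<^sub>0 'k) set)"
  have nz: "0 \<notin> A1 \<union> A2" using minimal_generators_nonzero[OF A] by blast
  have "minimal_generators A1 (submonoid_gen A1)"
    using minimal_generators_of_subset[OF A] by blast
  then have rel: "\<not> inj_on mdeg {u. Poly_Mapping.keys u \<subseteq> A1}"
    using mpd card by (intro mpd_semigroup_relation)
  have "0 \<notin> A1" using nz by blast
  obtain a b where ab: "Poly_Mapping.keys a \<subseteq> A1" "Poly_Mapping.keys b \<subseteq> A1" "a \<noteq> b" "mdeg a = mdeg b"
    and min: "\<And>c c'. Poly_Mapping.keys c \<subseteq> A1 \<Longrightarrow> Poly_Mapping.keys c' \<subseteq> A1 \<Longrightarrow> c \<noteq> c' \<Longrightarrow>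
       mdeg c = mdeg a \<Longrightarrow> mdeg c' = mdeg a \<Longrightarrow> Poly_Mapping.keys c \<inter> Poly_Mapping.keys c' = {}"
    by (rule minimal_relation[OF \<open>0 \<notin> A1\<close> rel], rule that; blast)
  obtain d where d: "Poly_Mapping.keys d \<subseteq> A1" "mdeg d = \<delta>"
    using submonoid_gen_imp_mdeg[OF \<delta>] by blast
  \<comment> \<open>Stated for an arbitrary ordered pair in the degree of \<open>a\<close>, since it
    is applied to \<open>a\<close>, \<open>b\<close> and to \<open>b\<close>,
    \<open>a\<close>.\<close>
  have key: "d \<noteq> 0 \<and> Poly_Mapping.keys d \<subseteq> Poly_Mapping.keys q"
    if p: "Poly_Mapping.keys p \<subseteq> A1" and q: "Poly_Mapping.keys q \<subseteq> A1" and "p \<noteq> q"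
      and deg: "mdeg p = mdeg a" "mdeg q = mdeg a" for p q
  proof -
    have pq: "Poly_Mapping.keys p \<inter> Poly_Mapping.keys q = {}"
      using min[OF p q \<open>p \<noteq> q\<close> deg] .
    have q_ne: "Poly_Mapping.keys q \<noteq> {}"
    proof
      assume "Poly_Mapping.keys q = {}"
      then have "q = 0" by simp
      then have "mdeg p = 0" using deg by simp
      then have "p = 0" using mdeg_eq_0_iff[of p] p nz by blast
      then show False using \<open>q = 0\<close> \<open>p \<noteq> q\<close> by simp
    qed
    have "Poly_Mapping.keys p \<subseteq> A1 \<union> A2" "Poly_Mapping.keys q \<subseteq> A1 \<union> A2" using p q by auto
    then obtain u v w where uvw: "p = w + u" "u \<noteq> v" "mdeg u = mdeg v"
      "Poly_Mapping.keys u \<union> Poly_Mapping.keys v = A1 \<union> A2"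
      using generic_toric_ideal_divisor[OF gen] \<open>p \<noteq> q\<close> deg by metis
    \<comment> \<open>As x^u divides x^p, it involves only variables from \<open>A1\<close>. Full
      support then puts all of \<open>A2\<close> into \<open>v\<close>, together with the variables
      of \<open>A1\<close> missing from \<open>u\<close>.\<close>
    have w: "Poly_Mapping.keys w \<subseteq> A1" and u: "Poly_Mapping.keys u \<subseteq> A1"
      using p uvw(1) by (auto simp: keys_add_nat)
    have "Poly_Mapping.keys v \<subseteq> A1 \<union> A2" using uvw(4) by blast
    from exponent_split_support[OF this disj] obtain v1 v2 where
      v: "v = v1 + v2" "Poly_Mapping.keys v1 = Poly_Mapping.keys v \<inter> A1"
        "Poly_Mapping.keys v2 = Poly_Mapping.keys v \<inter> A2"
      by blast
    have v1: "Poly_Mapping.keys v1 \<subseteq> A1" "A1 \<subseteq> Poly_Mapping.keys u \<union> Poly_Mapping.keys v1"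
      and v2: "Poly_Mapping.keys v2 = A2"
      using v uvw(4) u disj by auto
    have "v2 \<noteq> 0" using v2 ne by auto
    then have v2_deg: "mdeg v2 \<noteq> 0" using mdeg_eq_0_iff[of v2] v2 nz by auto
    have "mdeg u = mdeg v1 + mdeg v2" using uvw(3) v(1) by (simp add: mdeg_add)
    with gluing_degree_exchange[OF group d u v1(1) _ v2_deg] v2
    obtain e where e: "Poly_Mapping.keys e \<subseteq> A1" "mdeg v2 = mdeg d + mdeg e" "\<delta> \<noteq> 0" by blast
    \<comment> \<open>In \<open>p = w + u\<close>, \<open>u\<close> is traded for
      \<open>v1 + v2\<close>, and then \<open>v2\<close> for \<open>d + e\<close> of the same
      degree, so \<open>c\<close> stays on \<open>A1\<close> and in the degree of
      \<open>p\<close>.\<close>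
    define c where "c = w + (v1 + (d + e))"
    have c: "Poly_Mapping.keys c \<subseteq> A1" "mdeg c = mdeg a"
      using w v1 d e uvw v(1) deg by (auto simp: c_def keys_add_nat mdeg_add)
    \<comment> \<open>If \<open>c = p\<close>, cancelling \<open>w\<close> shows that
      \<open>u\<close> contains \<open>v1\<close>; then \<open>u\<close>, and with it
      \<open>p\<close>, involves all of \<open>A1\<close>, which leaves no variable for the disjoint
      nonempty \<open>q\<close>.\<close>
    have "c \<noteq> p"
    proof
      assume "c = p"
      then have "u = v1 + (d + e)" using uvw(1) by (simp add: c_def)
      then have "A1 \<subseteq> Poly_Mapping.keys p" using v1(2) uvw(1) by (auto simp: keys_add_nat)
      then show False using pq q q_ne by blast
    qed
    \<comment> \<open>Variables of \<open>q\<close> do not occur in \<open>p\<close>, so they occur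
      in \<open>c\<close>. Exponents in this degree that share a variable coincide, hence
      \<open>c = q\<close>, and \<open>d\<close> is a summand of \<open>c\<close>.\<close>
    moreover have "A1 \<subseteq> Poly_Mapping.keys p \<union> Poly_Mapping.keys c"
      using v1(2) uvw(1) by (auto simp: c_def keys_add_nat)
    then have "Poly_Mapping.keys c \<inter> Poly_Mapping.keys q \<noteq> {}" using pq q q_ne by blast
    ultimately have "c = q" using min[OF c(1) q _ c(2) deg(2)] by blast
    moreover have "d \<noteq> 0" using e(3) d(2) by auto
    ultimately show ?thesis by (auto simp: c_def keys_add_nat)
  qed
  have "d \<noteq> 0" "Poly_Mapping.keys d \<subseteq> Poly_Mapping.keys b"
    using key[OF ab(1-3) refl ab(4)[symmetric]] by simp_all
  moreover have "Poly_Mapping.keys d \<subseteq> Poly_Mapping.keys a"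
    using key[OF ab(2,1) ab(3)[symmetric] ab(4)[symmetric] refl] by simp
  moreover have "Poly_Mapping.keys a \<inter> Poly_Mapping.keys b = {}"
    using min[OF ab(1-3) refl ab(4)[symmetric]] .
  ultimately have "Poly_Mapping.keys d = {}" by blast
  then show False using \<open>d \<noteq> 0\<close> by simp
qed

theorem corollary6p8:
  fixes S S1 S2 A :: "(nat ^ 'd) set" and n :: nat
  assumes "n \<ge> 3"
    and "minimal_generators A S" and "card A = n"
    and "gluing S S1 S2"
    and "mpd_semigroup TYPE('k::field) S1" and "mpd_semigroup TYPE('k) S2"
  shows "\<not> generic_ideal A (toric_ideal A :: ((nat ^ 'd \<Rightarrow>\<^sub>0 nat) \<Rightarrow>\<^sub>0 'k) set)"
proof -
  obtain A' A1 A2 \<delta> where *: "minimal_generators A' S" "A' = A1 \<union> A2" "A1 \<inter> A2 = {}"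
    "A1 \<noteq> {}" "A2 \<noteq> {}" "S1 = submonoid_gen A1" "S2 = submonoid_gen A2"
    "\<delta> \<in> S1" "\<delta> \<in> S2" "group_of S1 \<inter> group_of S2 = {z *s int_vec \<delta> | z :: int. True}"
    using assms(4) unfolding gluing_def by blast
  have A: "A = A1 \<union> A2" using minimal_generators_unique[OF assms(2) *(1)] *(2) by simp
  have "finite A" using assms(2) by (simp add: minimal_generators_def)
  then have "card A = card A1 + card A2" using A *(3) by (simp add: card_Un_disjoint)
  \<comment> \<open>With at least three generators, the two parts cannot both be singletons.\<close>
  then consider "card A1 \<noteq> 1" | "card A2 \<noteq> 1" using assms(1,3) by linarith
  then show ?thesis
  proof cases
    case 1
    show ?thesis
      unfolding A by (rule gluing_not_generic) (use * assms A 1 in auto)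
  next
    case 2
    show ?thesis
      \<comment> \<open>The gluing condition is symmetric, so the parts exchange roles.\<close>
      unfolding A Un_commute[of A1]
      by (rule gluing_not_generic) (use * assms A 2 in \<open>auto simp: Un_commute Int_commute\<close>)
  qed
qed

end
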